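(* Let $G=(V,E)$ be a graph and let $C\subseteq V$ induce a $5$-cycle in $G$. If $X_C=(X_{ij})_{i,j\in C}\in\mathrm{STAB}^2(G_C)$, then $$\sum_{i\in C}X_{ii}\le1+\sum_{\{i,j\}\in\overline{E}(G_C)}X_{ij}.$$
   Context: Graphs are finite, simple and undirected. For $C\subseteq V$, $G_C$ is the subgraph of $G$ induced by $C$, and $\overline{E}(G_C)$ is the set of unordered pairs of distinct non-adjacent vertices of $G_C$. A cycle is a sequence of distinct vertices $i_1,\dots,i_k$ ($k\ge3$) such that consecutive vertices are adjacent and $i_k$ is adjacent to $i_1$; its length is $k$, and it may have chords (further edges between its vertices). A set $C$ induces a $5$-cycle in $G$ if $C$ is the vertex set of a cycle of length $5$ in $G$. For a graph $H$, $\mathcal{S}(H)\subseteq\{0,1\}^{V(H)}$ is the set of incidence vectors of stable sets of $H$ (including the empty set), $\mathcal{S}^2(H)=\{ss^\top : s\in\mathcal{S}(H)\}$, and $\mathrm{STAB}^2(H)=\mathrm{conv}\,\mathcal{S}^2(H)$. *)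

theory Defs
  imports "HOL-Analysis.Analysis"
begin

text \<open>
  A graph is a pair of a vertex set and a set of two-element vertex sets. All vertices live in a
  finite type \<open>'v\<close>, so that finiteness is automatic. The vertex set is not required to be the whole
  type, so that induced subgraphs are graphs over the same type.
\<close>

type_synonym 'v graph = "'v set \<times> 'v set set"

definition verts :: "'v graph \<Rightarrow> 'v set" where
  "verts G = fst G"

definition edges :: "'v graph \<Rightarrow> 'v set set" where
  "edges G = snd G"

definition simple_graph :: "'v::finite graph \<Rightarrow> bool" where
  "simple_graph G \<longleftrightarrow> (\<forall>e \<in> edges G. e \<subseteq> verts G \<and> card e = 2)"

definition induced_subgraph :: "'v graph \<Rightarrow> 'v set \<Rightarrow> 'v graph" where
  "induced_subgraph G C = (C, {e \<in> edges G. e \<subseteq> C})"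

definition non_edges :: "'v graph \<Rightarrow> 'v set set" where
  "non_edges G = {{i, j} | i j. i \<in> verts G \<and> j \<in> verts G \<and> i \<noteq> j \<and> {i, j} \<notin> edges G}"

definition is_cycle :: "'v graph \<Rightarrow> 'v list \<Rightarrow> bool" where
  "is_cycle G p \<longleftrightarrow> length p \<ge> 3 \<and> distinct p \<and> set p \<subseteq> verts G \<and>
     (\<forall>k. Suc k < length p \<longrightarrow> {p ! k, p ! Suc k} \<in> edges G) \<and>
     {last p, hd p} \<in> edges G"

text \<open>Chords are allowed: only the edges along the cycle are prescribed.\<close>

definition induces_5_cycle :: "'v graph \<Rightarrow> 'v set \<Rightarrow> bool" where
  "induces_5_cycle G C \<longleftrightarrow> (\<exists>p. is_cycle G p \<and> length p = 5 \<and> set p = C)"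

definition stable_set :: "'v graph \<Rightarrow> 'v set \<Rightarrow> bool" where
  "stable_set G S \<longleftrightarrow> S \<subseteq> verts G \<and> (\<forall>i\<in>S. \<forall>j\<in>S. {i, j} \<notin> edges G)"

text \<open>
  Vectors indexed by \<open>verts H\<close> and matrices indexed by \<open>verts H \<times> verts H\<close> are represented by
  their extensions by zero to the whole vertex type. This embedding is linear and injective, so it
  commutes with taking convex hulls.
\<close>

definition incidence_vector :: "'v set \<Rightarrow> real ^ 'v::finite" where
  "incidence_vector S = (\<chi> i. if i \<in> S then 1 else 0)"

definition stable_vectors :: "'v::finite graph \<Rightarrow> (real ^ 'v) set" where
  "stable_vectors H = {incidence_vector S | S. stable_set H S}"

definition stable_matrices :: "'v::finite graph \<Rightarrow> (real ^ 'v ^ 'v) set" where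
  "stable_matrices H = {(columnvector s :: real ^ 1 ^ 'v) ** rowvector s | s. s \<in> stable_vectors H}"

definition STAB2 :: "'v::finite graph \<Rightarrow> (real ^ 'v ^ 'v) set" where
  "STAB2 H = convex hull (stable_matrices H)"

definition principal_submatrix :: "real ^ 'v ^ 'v \<Rightarrow> 'v set \<Rightarrow> real ^ 'v ^ 'v::finite" where
  "principal_submatrix X C = (\<chi> i j. if i \<in> C \<and> j \<in> C then X $ i $ j else 0)"

text \<open>
  The entry \<open>X\<^sub>i\<^sub>j\<close> at an unordered pair \<open>{i, j}\<close>, meaningful only where \<open>X\<close> is
  symmetric.
\<close>

definition pair_entry :: "real ^ 'v ^ 'v \<Rightarrow> 'v::finite set \<Rightarrow> real" where
  "pair_entry X e = (THE x. \<exists>i j. e = {i, j} \<and> x = X $ i $ j)"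

lemma pair_entry_doubleton:
  assumes "X $ i $ j = X $ j $ i"
  shows "pair_entry X {i, j} = X $ i $ j"
  unfolding pair_entry_def
  by (rule the_equality) (use assms in \<open>auto simp: doubleton_eq_iff\<close>)

lemma outer_product_nth:
  "((columnvector s :: real ^ 1 ^ 'v) ** rowvector s) $ i $ j = s $ i * s $ (j :: 'v::finite)"
  for s :: "real ^ 'v"
  by (simp add: matrix_matrix_mult_def columnvector_def rowvector_def)

lemma STAB2_symmetric:
  assumes "X \<in> STAB2 H"
  shows "X $ i $ j = X $ j $ i"
proof -
  have "convex {X :: real ^ 'a ^ 'a. X $ i $ j = X $ j $ i}"
    by (auto simp: convex_def)
  moreover have "stable_matrices H \<subseteq> {X. X $ i $ j = X $ j $ i}"
    by (auto simp: stable_matrices_def outer_product_nth)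
  ultimately have "STAB2 H \<subseteq> {X. X $ i $ j = X $ j $ i}"
    unfolding STAB2_def by (rule hull_minimal[rotated])
  with assms show ?thesis by blast
qed

end

theory Submission imports Defs
begin

text \<open>
  The inequality is linear on symmetric matrices, so it suffices to check it at the generators
  \<open>s s\<^sup>T\<close> of \<open>STAB2\<close>, where \<open>s\<close> is the incidence vector of a stable set \<open>S\<close>. There the trace is
  \<open>k = card S\<close>. The entry at a pair is 1 if the pair lies in \<open>S\<close> and 0 otherwise, and all pairs in
  \<open>S\<close> are non-edges because \<open>S\<close> is stable; hence the right-hand sum counts all \<open>k choose 2\<close> pairs
  in \<open>S\<close>. The claim becomes \<open>k \<le> 1 + k (k - 1) / 2\<close>, that is, \<open>(k - 1) (k - 2) \<ge> 0\<close>, which holds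
  because no natural number lies strictly between 1 and 2.

  \<open>STAB2_trace_le_one_plus_non_edges\<close> is this bound for a graph \<open>H\<close>; the theorem applies it to the
  graph induced by \<open>C\<close>, whose non-edges lie inside \<open>C\<close>, where \<open>X\<close> and its principal submatrix
  have the same entries.
\<close>

lemma le_Suc_choose_two: "n \<le> Suc (n choose 2)"
  by (induction n) (auto simp: numeral_2_eq_2)

text \<open>A pair inside a stable set cannot be an edge; so the non-edge sum at a stable set counts all its pairs.\<close>

lemma non_edges_within_stable_set:
  assumes "stable_set H S"
  shows "{e \<in> non_edges H. e \<subseteq> S} = {e. e \<subseteq> S \<and> card e = 2}"
proof (intro Collect_cong iffI conjI; elim conjE)
  fix e assume "e \<subseteq> S" "card e = 2"
  then obtain i j where "e = {i, j}" "i \<noteq> j" "i \<in> S" "j \<in> S"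
    by (auto simp: card_2_iff)
  with assms show "e \<in> non_edges H"
    unfolding non_edges_def stable_set_def by blast
qed (auto simp: non_edges_def)

lemma pair_entry_outer_product_incidence_vector:
  assumes "e \<in> non_edges H"
  shows "pair_entry ((columnvector (incidence_vector S) :: real ^ 1 ^ 'v::finite)
           ** rowvector (incidence_vector S)) e = (if e \<subseteq> S then 1 else 0)"
proof -
  obtain i j where "e = {i, j}"
    using assms by (auto simp: non_edges_def)
  then show ?thesis
    by (auto simp: pair_entry_doubleton outer_product_nth incidence_vector_def)
qed

lemma trace_le_one_plus_non_edges_stable_matrix:
  fixes H :: "'v::finite graph"
  assumes "X \<in> stable_matrices H"
  shows "(\<Sum>i\<in>verts H. X $ i $ i) \<le> 1 + (\<Sum>e\<in>non_edges H. pair_entry X e)"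
proof -
  obtain S where S: "stable_set H S"
    and X: "X = (columnvector (incidence_vector S) :: real ^ 1 ^ 'v) ** rowvector (incidence_vector S)"
    using assms by (auto simp: stable_matrices_def stable_vectors_def)
  have "S \<subseteq> verts H"
    using S by (simp add: stable_set_def)
  have "(\<Sum>i\<in>verts H. X $ i $ i) = (\<Sum>i\<in>verts H. if i \<in> S then 1 else 0)"
    by (rule sum.cong) (auto simp: X outer_product_nth incidence_vector_def)
  also have "\<dots> = real (card S)"
    using \<open>S \<subseteq> verts H\<close> by (simp add: sum.If_cases Int_absorb1)
  finally have trace: "(\<Sum>i\<in>verts H. X $ i $ i) = real (card S)" .
  have "(\<Sum>e\<in>non_edges H. pair_entry X e) = (\<Sum>e\<in>non_edges H. if e \<subseteq> S then 1 else 0)"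
    by (rule sum.cong) (auto simp: X pair_entry_outer_product_incidence_vector)
  also have "\<dots> = real (card {e \<in> non_edges H. e \<subseteq> S})"
    by (simp add: sum.If_cases Collect_conj_eq)
  also have "\<dots> = real (card S choose 2)"
    by (simp add: non_edges_within_stable_set[OF S] n_subsets)
  finally have "(\<Sum>e\<in>non_edges H. pair_entry X e) = real (card S choose 2)" .
  with trace le_Suc_choose_two[of "card S"] show ?thesis
    by linarith
qed

lemma pair_entry_linear_combination:
  assumes "e \<in> non_edges H"
    and "\<And>i j. X $ i $ j = X $ j $ i" and "\<And>i j. Y $ i $ j = Y $ j $ i"
  shows "pair_entry (u *\<^sub>R X + v *\<^sub>R Y) e = u * pair_entry X e + v * pair_entry Y e"
proof -
  obtain i j where e: "e = {i, j}"
    using assms(1) by (auto simp: non_edges_def)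
  show ?thesis
    unfolding e using assms(2,3)[of i j] by (simp add: pair_entry_doubleton)
qed

text \<open>
  Symmetry is part of the set because \<open>pair_entry\<close> is linear only on symmetric matrices.
\<close>

lemma convex_trace_le_one_plus_non_edges:
  fixes H :: "'v::finite graph"
  shows "convex {X :: real ^ 'v ^ 'v. (\<forall>i j. X $ i $ j = X $ j $ i) \<and>
           (\<Sum>i\<in>verts H. X $ i $ i) \<le> 1 + (\<Sum>e\<in>non_edges H. pair_entry X e)}"
    (is "convex {X. ?sym X \<and> ?tr X \<le> 1 + ?ne X}")
proof (rule convexI)
  fix X Y :: "real ^ 'v ^ 'v" and u v :: real
  assume X: "X \<in> {X. ?sym X \<and> ?tr X \<le> 1 + ?ne X}"
    and Y: "Y \<in> {X. ?sym X \<and> ?tr X \<le> 1 + ?ne X}"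
    and uv: "0 \<le> u" "0 \<le> v" "u + v = 1"
  let ?Z = "u *\<^sub>R X + v *\<^sub>R Y"
  have sym: "?sym X" "?sym Y"
    using X Y by blast+
  have "?tr ?Z = u * ?tr X + v * ?tr Y"
    by (simp add: sum.distrib sum_distrib_left)
  also have "\<dots> \<le> u * (1 + ?ne X) + v * (1 + ?ne Y)"
    using X Y uv by (intro add_mono mult_left_mono) auto
  also have "\<dots> = 1 + (u * ?ne X + v * ?ne Y)"
    using uv by (simp add: algebra_simps)
  also have "u * ?ne X + v * ?ne Y = (\<Sum>e\<in>non_edges H. u * pair_entry X e + v * pair_entry Y e)"
    by (simp add: sum.distrib sum_distrib_left)
  also have "\<dots> = ?ne ?Z"
    using sym by (intro sum.cong refl) (simp add: pair_entry_linear_combination)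
  finally have "?tr ?Z \<le> 1 + ?ne ?Z" .
  moreover have "?sym ?Z"
    using sym by simp
  ultimately show "?Z \<in> {X. ?sym X \<and> ?tr X \<le> 1 + ?ne X}"
    by blast
qed

lemma STAB2_trace_le_one_plus_non_edges:
  fixes H :: "'v::finite graph"
  assumes "X \<in> STAB2 H"
  shows "(\<Sum>i\<in>verts H. X $ i $ i) \<le> 1 + (\<Sum>e\<in>non_edges H. pair_entry X e)"
proof -
  have "stable_matrices H \<subseteq> {X. (\<forall>i j. X $ i $ j = X $ j $ i) \<and>
      (\<Sum>i\<in>verts H. X $ i $ i) \<le> 1 + (\<Sum>e\<in>non_edges H. pair_entry X e)}"
  proof (intro subsetI CollectI conjI)
    fix X assume X: "X \<in> stable_matrices H"
    then show "\<forall>i j. X $ i $ j = X $ j $ i"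
      by (auto simp: stable_matrices_def outer_product_nth)
    show "(\<Sum>i\<in>verts H. X $ i $ i) \<le> 1 + (\<Sum>e\<in>non_edges H. pair_entry X e)"
      by (rule trace_le_one_plus_non_edges_stable_matrix[OF X])
  qed
  then have "STAB2 H \<subseteq> {X. (\<forall>i j. X $ i $ j = X $ j $ i) \<and>
      (\<Sum>i\<in>verts H. X $ i $ i) \<le> 1 + (\<Sum>e\<in>non_edges H. pair_entry X e)}"
    unfolding STAB2_def by (rule hull_minimal) (rule convex_trace_le_one_plus_non_edges)
  with assms show ?thesis
    by blast
qed

lemma pair_entry_principal_submatrix:
  assumes "e \<subseteq> C"
  shows "pair_entry (principal_submatrix X C) e = pair_entry X e"
proof -
  have "e = {i, j} \<and> x = principal_submatrix X C $ i $ j \<longleftrightarrow> e = {i, j} \<and> x = X $ i $ j" for x i j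
    using assms by (auto simp: principal_submatrix_def)
  then show ?thesis
    unfolding pair_entry_def by presburger
qed

theorem corollary11:
  fixes G :: "'v::finite graph" and C :: "'v set" and X :: "real ^ 'v ^ 'v"
  assumes "simple_graph G"
    and "C \<subseteq> verts G"
    and "induces_5_cycle G C"
    and "principal_submatrix X C \<in> STAB2 (induced_subgraph G C)"
  shows "(\<Sum>i\<in>C. X $ i $ i) \<le> 1 + (\<Sum>e\<in>non_edges (induced_subgraph G C). pair_entry X e)"
proof -
  let ?H = "induced_subgraph G C" and ?Y = "principal_submatrix X C"
  have verts: "verts ?H = C"
    by (simp add: induced_subgraph_def verts_def)
  have "(\<Sum>i\<in>C. X $ i $ i) = (\<Sum>i\<in>verts ?H. ?Y $ i $ i)"
    unfolding verts by (simp add: principal_submatrix_def)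
  also have "\<dots> \<le> 1 + (\<Sum>e\<in>non_edges ?H. pair_entry ?Y e)"
    by (rule STAB2_trace_le_one_plus_non_edges[OF assms(4)])
  also have "(\<Sum>e\<in>non_edges ?H. pair_entry ?Y e) = (\<Sum>e\<in>non_edges ?H. pair_entry X e)"
  proof (rule sum.cong)
    fix e assume "e \<in> non_edges ?H"
    then have "e \<subseteq> C"
      by (auto simp: non_edges_def verts)
    then show "pair_entry ?Y e = pair_entry X e"
      by (rule pair_entry_principal_submatrix)
  qed simp
  finally show ?thesis .
qed

end
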